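(* Let $(\Xi,\rho,\theta,\Sigma)$ be a continuous groupoid action. If $\Xi$ is open and $\Sigma$ is a Baire second-countable space, then topological transitivity, recurrent transitivity and pointwise transitivity are equivalent, and they are also equivalent to each of the following properties: (i) $\Sigma$ is not the union of two proper invariant closed subsets; (ii) each non-empty open invariant subset of $\Sigma$ is dense.
   Context: All topological spaces are Hausdorff. A groupoid $\Xi$ is a small category in which all arrows are invertible; $X=\Xi^{(0)}$ is its unit space, $d,r:\Xi\to X$ are the source and range maps, and $\xi\eta$ is defined iff $d(\xi)=r(\eta)$. A topological groupoid is a groupoid with a (Hausdorff) topology making inversion and multiplication continuous (composable pairs carry the topology induced from $\Xi\times\Xi$); $X$ has the subspace topology. $\Xi$ is called open if $d:\Xi\to X$ is an open map. For $x\in X$, $\Xi_x=d^{-1}(\{x\})$. A continuous groupoid action $(\Xi,\rho,\theta,\Sigma)$ consists of a topological groupoid $\Xi$, a Hausdorff space $\Sigma$, a continuous surjection $\rho:\Sigma\to X$ (the anchor) and a continuous map $\theta:\{(\xi,\sigma)\in\Xi\times\Sigma: d(\xi)=\rho(\sigma)\}\to\Sigma$, $\theta_\xi(\sigma)=\xi\bullet\sigma$, with $\rho(\sigma)\bullet\sigma=\sigma$ and: if $d(\xi)=r(\eta)$ and $d(\eta)=\rho(\sigma)$ then $d(\xi)=\rho(\eta\bullet\sigma)$ and $(\xi\eta)\bullet\sigma=\xi\bullet(\eta\bullet\sigma)$. For $M\subset\Sigma$, $\xi\bullet M=\{\xi\bullet\sigma:\sigma\in M,\ \rho(\sigma)=d(\xi)\}$.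 $M$ is invariant if $\xi\bullet M\subset M$ for all $\xi\in\Xi$. The orbit of $\sigma$ is $\{\xi\bullet\sigma:\xi\in\Xi_{\rho(\sigma)}\}$. The recurrence set is $\widetilde\Xi_M^N=\{\xi\in\Xi:(\xi\bullet M)\cap N\neq\emptyset\}$ for $M,N\subset\Sigma$. The action is pointwise transitive if there is a dense orbit; recurrently transitive if $\widetilde\Xi_U^V\neq\emptyset$ for all non-void open $U,V\subset\Sigma$; topologically transitive if each invariant subset of $\Sigma$ is either dense or nowhere dense. *)

theory Defs
  imports "HOL-Analysis.Analysis"
begin

text \<open>
  The arrows are the points of the topology \<open>arrows\<close>, and the unit space is a set of arrows.
  The product \<open>mult G \<xi> \<eta>\<close> is only meaningful when \<open>src G \<xi> = rng G \<eta>\<close>; outside the domains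
  given in the axioms below, the operations have arbitrary values.
\<close>

record 'g groupoid_data =
  arrows :: "'g topology"
  units :: "'g set"
  src :: "'g \<Rightarrow> 'g"
  rng :: "'g \<Rightarrow> 'g"
  mult :: "'g \<Rightarrow> 'g \<Rightarrow> 'g"
  inverse_arrow :: "'g \<Rightarrow> 'g"

definition composable :: "'g groupoid_data \<Rightarrow> ('g \<times> 'g) set" where
  "composable G = {(\<xi>, \<eta>). \<xi> \<in> topspace (arrows G) \<and> \<eta> \<in> topspace (arrows G) \<and> src G \<xi> = rng G \<eta>}"

definition is_groupoid :: "'g groupoid_data \<Rightarrow> bool" where
  "is_groupoid G \<longleftrightarrow>
     units G \<subseteq> topspace (arrows G) \<and>
     src G \<in> topspace (arrows G) \<rightarrow> units G \<and>
     rng G \<in> topspace (arrows G) \<rightarrow> units G \<and>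
     (\<forall>x \<in> units G. src G x = x \<and> rng G x = x) \<and>
     (\<forall>(\<xi>, \<eta>) \<in> composable G.
        mult G \<xi> \<eta> \<in> topspace (arrows G) \<and>
        src G (mult G \<xi> \<eta>) = src G \<eta> \<and> rng G (mult G \<xi> \<eta>) = rng G \<xi>) \<and>
     (\<forall>\<xi> \<eta> \<zeta>. (\<xi>, \<eta>) \<in> composable G \<and> (\<eta>, \<zeta>) \<in> composable G \<longrightarrow>
        mult G (mult G \<xi> \<eta>) \<zeta> = mult G \<xi> (mult G \<eta> \<zeta>)) \<and>
     (\<forall>\<xi> \<in> topspace (arrows G).
        mult G (rng G \<xi>) \<xi> = \<xi> \<and> mult G \<xi> (src G \<xi>) = \<xi>) \<and>
     (\<forall>\<xi> \<in> topspace (arrows G).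
        inverse_arrow G \<xi> \<in> topspace (arrows G) \<and>
        src G (inverse_arrow G \<xi>) = rng G \<xi> \<and> rng G (inverse_arrow G \<xi>) = src G \<xi> \<and>
        mult G (inverse_arrow G \<xi>) \<xi> = src G \<xi> \<and> mult G \<xi> (inverse_arrow G \<xi>) = rng G \<xi>)"

definition topological_groupoid :: "'g groupoid_data \<Rightarrow> bool" where
  "topological_groupoid G \<longleftrightarrow>
     is_groupoid G \<and>
     Hausdorff_space (arrows G) \<and>
     continuous_map (arrows G) (arrows G) (inverse_arrow G) \<and>
     continuous_map (subtopology (prod_topology (arrows G) (arrows G)) (composable G)) (arrows G)
       (\<lambda>(\<xi>, \<eta>). mult G \<xi> \<eta>)"

definition unit_space :: "'g groupoid_data \<Rightarrow> 'g topology" where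
  "unit_space G = subtopology (arrows G) (units G)"

definition open_groupoid :: "'g groupoid_data \<Rightarrow> bool" where
  "open_groupoid G \<longleftrightarrow> open_map (arrows G) (unit_space G) (src G)"

record ('g, 's) groupoid_action =
  groupoid :: "'g groupoid_data"
  anchor :: "'s \<Rightarrow> 'g"
  act :: "'g \<Rightarrow> 's \<Rightarrow> 's"
  space_of :: "'s topology"

definition actable :: "('g, 's) groupoid_action \<Rightarrow> ('g \<times> 's) set" where
  "actable A = {(\<xi>, \<sigma>). \<xi> \<in> topspace (arrows (groupoid A)) \<and> \<sigma> \<in> topspace (space_of A) \<and>
                       src (groupoid A) \<xi> = anchor A \<sigma>}"

definition continuous_groupoid_action :: "('g, 's) groupoid_action \<Rightarrow> bool" where
  "continuous_groupoid_action A \<longleftrightarrow>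
     topological_groupoid (groupoid A) \<and>
     Hausdorff_space (space_of A) \<and>
     continuous_map (space_of A) (unit_space (groupoid A)) (anchor A) \<and>
     anchor A ` topspace (space_of A) = units (groupoid A) \<and>
     continuous_map (subtopology (prod_topology (arrows (groupoid A)) (space_of A)) (actable A))
       (space_of A) (\<lambda>(\<xi>, \<sigma>). act A \<xi> \<sigma>) \<and>
     (\<forall>\<sigma> \<in> topspace (space_of A). act A (anchor A \<sigma>) \<sigma> = \<sigma>) \<and>
     (\<forall>\<xi> \<eta> \<sigma>. (\<xi>, \<eta>) \<in> composable (groupoid A) \<and> (\<eta>, \<sigma>) \<in> actable A \<longrightarrow>
        src (groupoid A) \<xi> = anchor A (act A \<eta> \<sigma>) \<and>
        act A (mult (groupoid A) \<xi> \<eta>) \<sigma> = act A \<xi> (act A \<eta> \<sigma>))"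

definition translate :: "('g, 's) groupoid_action \<Rightarrow> 'g \<Rightarrow> 's set \<Rightarrow> 's set" where
  "translate A \<xi> M = {act A \<xi> \<sigma> | \<sigma>. \<sigma> \<in> M \<and> anchor A \<sigma> = src (groupoid A) \<xi>}"

definition invariant :: "('g, 's) groupoid_action \<Rightarrow> 's set \<Rightarrow> bool" where
  "invariant A M \<longleftrightarrow>
     M \<subseteq> topspace (space_of A) \<and>
     (\<forall>\<xi> \<in> topspace (arrows (groupoid A)). translate A \<xi> M \<subseteq> M)"

definition orbit :: "('g, 's) groupoid_action \<Rightarrow> 's \<Rightarrow> 's set" where
  "orbit A \<sigma> =
     {act A \<xi> \<sigma> | \<xi>. \<xi> \<in> topspace (arrows (groupoid A)) \<and> src (groupoid A) \<xi> = anchor A \<sigma>}"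

definition recurrence_set :: "('g, 's) groupoid_action \<Rightarrow> 's set \<Rightarrow> 's set \<Rightarrow> 'g set" where
  "recurrence_set A M N = {\<xi> \<in> topspace (arrows (groupoid A)). translate A \<xi> M \<inter> N \<noteq> {}}"

definition dense_in :: "'a topology \<Rightarrow> 'a set \<Rightarrow> bool" where
  "dense_in T M \<longleftrightarrow> M \<subseteq> topspace T \<and> T closure_of M = topspace T"

definition nowhere_dense_in :: "'a topology \<Rightarrow> 'a set \<Rightarrow> bool" where
  "nowhere_dense_in T M \<longleftrightarrow> M \<subseteq> topspace T \<and> T interior_of (T closure_of M) = {}"

text \<open>
  Intersecting with \<open>topspace T\<close> only matters for the empty family, as \<open>\<Inter>{} = UNIV\<close>.
\<close>

definition Baire_space :: "'a topology \<Rightarrow> bool" where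
  "Baire_space T \<longleftrightarrow>
     (\<forall>\<D>. countable \<D> \<and> (\<forall>D \<in> \<D>. openin T D \<and> dense_in T D) \<longrightarrow>
        dense_in T (topspace T \<inter> \<Inter>\<D>))"

definition pointwise_transitive :: "('g, 's) groupoid_action \<Rightarrow> bool" where
  "pointwise_transitive A \<longleftrightarrow>
     (\<exists>\<sigma> \<in> topspace (space_of A). dense_in (space_of A) (orbit A \<sigma>))"

definition recurrently_transitive :: "('g, 's) groupoid_action \<Rightarrow> bool" where
  "recurrently_transitive A \<longleftrightarrow>
     (\<forall>U V. openin (space_of A) U \<and> U \<noteq> {} \<and> openin (space_of A) V \<and> V \<noteq> {} \<longrightarrow>
        recurrence_set A U V \<noteq> {})"

definition topologically_transitive :: "('g, 's) groupoid_action \<Rightarrow> bool" where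
  "topologically_transitive A \<longleftrightarrow>
     (\<forall>M. invariant A M \<longrightarrow> dense_in (space_of A) M \<or> nowhere_dense_in (space_of A) M)"

end

theory Submission
  imports Defs
begin

text \<open>
  The orbits partition \<open>\<Sigma>\<close>, and the action matters only through this partition: a set is invariant
  when it contains the orbit of each of its points, and \<open>U\<close> recurs to \<open>V\<close> when some orbit meets
  both. The topology of \<open>\<Xi>\<close> enters only once: if \<open>\<Xi>\<close> is open, then the union of the orbits that
  meet an open set is open (\<open>openin_saturation\<close>). Hence interiors and closures of invariant sets are
  invariant.

  All properties are compared with (ii), the density of the non-void open invariant sets. Recurrent
  transitivity says that the saturation of each non-void open set is dense, and such saturations are
  exactly the non-void open invariant sets. Property (i) is (ii) after passing to complements.
  Topological transitivity implies (ii), as a non-void open set is not nowhere dense. Conversely, under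
  (ii), if the closure of an invariant set has non-void interior, then this interior is invariant,
  hence dense, and the closure is everything. A dense orbit meets all non-void open sets, which gives
  recurrence. For the converse the Baire property is applied to the saturations of the members of a
  countable base, the empty set left out: a point lies in all of them exactly when its orbit is dense.
\<close>

section \<open>Dense sets\<close>

lemma dense_inI:
  assumes "M \<subseteq> topspace T" "\<And>V. openin T V \<Longrightarrow> V \<noteq> {} \<Longrightarrow> M \<inter> V \<noteq> {}"
  shows "dense_in T M"
  using assms unfolding dense_in_def dense_intersects_open by blast

lemma dense_inD:
  assumes "dense_in T M" "openin T V" "V \<noteq> {}"
  shows "M \<inter> V \<noteq> {}"
  using assms unfolding dense_in_def dense_intersects_open by blast

section \<open>Orbits as equivalence classes\<close>

lemma is_groupoid_of_action:
  assumes "continuous_groupoid_action A"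
  shows "is_groupoid (groupoid A)"
  using assms by (simp add: continuous_groupoid_action_def topological_groupoid_def)

lemma act_in_topspace:
  assumes "continuous_groupoid_action A" "(\<xi>, \<sigma>) \<in> actable A"
  shows "act A \<xi> \<sigma> \<in> topspace (space_of A)"
proof -
  have "continuous_map (subtopology (prod_topology (arrows (groupoid A)) (space_of A)) (actable A))
       (space_of A) (\<lambda>(\<xi>, \<sigma>). act A \<xi> \<sigma>)"
    using assms(1) by (simp add: continuous_groupoid_action_def)
  from continuous_map_image_subset_topspace[OF this] assms(2) show ?thesis
    by (force simp: actable_def)
qed

lemma anchor_in_units:
  assumes "continuous_groupoid_action A" "\<sigma> \<in> topspace (space_of A)"
  shows "anchor A \<sigma> \<in> units (groupoid A)"
  using assms by (auto simp: continuous_groupoid_action_def)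

lemma act_mult:
  assumes "continuous_groupoid_action A" "(\<xi>, \<eta>) \<in> composable (groupoid A)" "(\<eta>, \<sigma>) \<in> actable A"
  shows "act A (mult (groupoid A) \<xi> \<eta>) \<sigma> = act A \<xi> (act A \<eta> \<sigma>)"
    and "src (groupoid A) \<xi> = anchor A (act A \<eta> \<sigma>)"
  using assms unfolding continuous_groupoid_action_def by blast+

text \<open>
  The axioms give the anchor of \<open>\<eta> \<bullet> \<sigma>\<close> only as the source of an arrow composable with \<open>\<eta>\<close>; the
  unit \<open>r(\<eta>)\<close> is always such an arrow.
\<close>

lemma anchor_act:
  assumes A: "continuous_groupoid_action A" and "(\<eta>, \<sigma>) \<in> actable A"
  shows "anchor A (act A \<eta> \<sigma>) = rng (groupoid A) \<eta>"
proof -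
  have "\<eta> \<in> topspace (arrows (groupoid A))"
    using assms(2) by (simp add: actable_def)
  then have "rng (groupoid A) \<eta> \<in> units (groupoid A)"
    using is_groupoid_of_action[OF A] by (auto simp: is_groupoid_def)
  then have u: "src (groupoid A) (rng (groupoid A) \<eta>) = rng (groupoid A) \<eta>"
    and "rng (groupoid A) \<eta> \<in> topspace (arrows (groupoid A))"
    using is_groupoid_of_action[OF A] by (auto simp: is_groupoid_def)
  then have "(rng (groupoid A) \<eta>, \<eta>) \<in> composable (groupoid A)"
    using \<open>\<eta> \<in> _\<close> by (simp add: composable_def)
  from act_mult(2)[OF A this assms(2)] u show ?thesis by simp
qed

lemma mem_orbit_iff:
  assumes "\<sigma> \<in> topspace (space_of A)"
  shows "\<tau> \<in> orbit A \<sigma> \<longleftrightarrow> (\<exists>\<xi>. (\<xi>, \<sigma>) \<in> actable A \<and> \<tau> = act A \<xi> \<sigma>)"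
  using assms by (auto simp: orbit_def actable_def)

lemma orbit_subset_topspace:
  assumes "continuous_groupoid_action A" "\<sigma> \<in> topspace (space_of A)"
  shows "orbit A \<sigma> \<subseteq> topspace (space_of A)"
  using act_in_topspace[OF assms(1)] by (auto simp: mem_orbit_iff[OF assms(2)])

lemma mem_orbit_self:
  assumes A: "continuous_groupoid_action A" and \<sigma>: "\<sigma> \<in> topspace (space_of A)"
  shows "\<sigma> \<in> orbit A \<sigma>"
proof -
  have "(anchor A \<sigma>, \<sigma>) \<in> actable A"
    using anchor_in_units[OF A \<sigma>] is_groupoid_of_action[OF A] \<sigma>
    by (auto simp: actable_def is_groupoid_def)
  moreover have "act A (anchor A \<sigma>) \<sigma> = \<sigma>"
    using A \<sigma> by (simp add: continuous_groupoid_action_def)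
  ultimately show ?thesis
    using mem_orbit_iff[OF \<sigma>] by metis
qed

lemma mem_orbit_sym:
  assumes A: "continuous_groupoid_action A" and \<sigma>: "\<sigma> \<in> topspace (space_of A)"
    and "\<tau> \<in> orbit A \<sigma>"
  shows "\<sigma> \<in> orbit A \<tau>"
proof -
  let ?G = "groupoid A"
  obtain \<xi> where \<xi>: "(\<xi>, \<sigma>) \<in> actable A" and \<tau>: "\<tau> = act A \<xi> \<sigma>"
    using assms(3) mem_orbit_iff[OF \<sigma>] by blast
  let ?\<eta> = "inverse_arrow ?G \<xi>"
  have arr: "\<xi> \<in> topspace (arrows ?G)" and src: "src ?G \<xi> = anchor A \<sigma>"
    using \<xi> by (auto simp: actable_def)
  have inv: "?\<eta> \<in> topspace (arrows ?G)" "src ?G ?\<eta> = rng ?G \<xi>" "mult ?G ?\<eta> \<xi> = src ?G \<xi>"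
    using is_groupoid_of_action[OF A] arr by (auto simp: is_groupoid_def)
  then have "(?\<eta>, \<xi>) \<in> composable ?G"
    using arr by (simp add: composable_def)
  then have "act A ?\<eta> \<tau> = act A (anchor A \<sigma>) \<sigma>"
    using act_mult(1)[OF A _ \<xi>] \<tau> inv(3) src by force
  also have "\<dots> = \<sigma>"
    using A \<sigma> by (simp add: continuous_groupoid_action_def)
  finally have "act A ?\<eta> \<tau> = \<sigma>" .
  moreover have "\<tau> \<in> topspace (space_of A)"
    using act_in_topspace[OF A \<xi>] \<tau> by simp
  moreover from this have "(?\<eta>, \<tau>) \<in> actable A"
    using inv anchor_act[OF A \<xi>] \<tau> by (simp add: actable_def)
  ultimately show ?thesis
    using mem_orbit_iff[of \<tau> A \<sigma>] by blast
qed

lemma mem_orbit_trans: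
  assumes A: "continuous_groupoid_action A" and \<sigma>: "\<sigma> \<in> topspace (space_of A)"
    and \<tau>: "\<tau> \<in> orbit A \<sigma>" and \<upsilon>: "\<upsilon> \<in> orbit A \<tau>"
  shows "\<upsilon> \<in> orbit A \<sigma>"
proof -
  let ?G = "groupoid A"
  obtain \<eta> where \<eta>: "(\<eta>, \<sigma>) \<in> actable A" "\<tau> = act A \<eta> \<sigma>"
    using \<tau> mem_orbit_iff[OF \<sigma>] by blast
  have "\<tau> \<in> topspace (space_of A)"
    using act_in_topspace[OF A \<eta>(1)] \<eta>(2) by simp
  then obtain \<xi> where \<xi>: "(\<xi>, \<tau>) \<in> actable A" "\<upsilon> = act A \<xi> \<tau>"
    using \<upsilon> mem_orbit_iff[of \<tau> A \<upsilon>] by blast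
  have comp: "(\<xi>, \<eta>) \<in> composable ?G"
    using \<eta> \<xi> anchor_act[OF A \<eta>(1)] by (auto simp: actable_def composable_def)
  then have "mult ?G \<xi> \<eta> \<in> topspace (arrows ?G)" "src ?G (mult ?G \<xi> \<eta>) = src ?G \<eta>"
    using is_groupoid_of_action[OF A] by (auto simp: is_groupoid_def)
  then have "(mult ?G \<xi> \<eta>, \<sigma>) \<in> actable A"
    using \<eta>(1) by (auto simp: actable_def)
  moreover have "\<upsilon> = act A (mult ?G \<xi> \<eta>) \<sigma>"
    using act_mult(1)[OF A comp \<eta>(1)] \<eta> \<xi> by simp
  ultimately show ?thesis
    using mem_orbit_iff[OF \<sigma>] by blast
qed

section \<open>Invariance and recurrence in terms of orbits\<close>

lemma invariant_iff_orbits: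
  "invariant A M \<longleftrightarrow> M \<subseteq> topspace (space_of A) \<and> (\<forall>\<sigma>\<in>M. orbit A \<sigma> \<subseteq> M)"
  unfolding invariant_def translate_def orbit_def by fastforce

lemma recurrence_set_nonempty_iff_orbits:
  "recurrence_set A U V \<noteq> {} \<longleftrightarrow> (\<exists>\<sigma>\<in>U. orbit A \<sigma> \<inter> V \<noteq> {})"
  unfolding recurrence_set_def translate_def orbit_def by fastforce

lemma invariant_complement:
  assumes A: "continuous_groupoid_action A" and "invariant A M"
  shows "invariant A (topspace (space_of A) - M)"
  using assms(2) mem_orbit_sym[OF A] orbit_subset_topspace[OF A]
  unfolding invariant_iff_orbits by blast

section \<open>Saturations of open sets\<close>

definition saturation :: "('g, 's) groupoid_action \<Rightarrow> 's set \<Rightarrow> 's set" where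
  "saturation A M = {\<sigma> \<in> topspace (space_of A). orbit A \<sigma> \<inter> M \<noteq> {}}"

lemma subset_saturation:
  assumes "continuous_groupoid_action A" "M \<subseteq> topspace (space_of A)"
  shows "M \<subseteq> saturation A M"
  using assms(2) mem_orbit_self[OF assms(1)] by (auto simp: saturation_def)

lemma invariant_saturation:
  assumes A: "continuous_groupoid_action A"
  shows "invariant A (saturation A M)"
  unfolding invariant_iff_orbits
proof (intro conjI ballI subsetI)
  fix \<sigma> \<tau> assume \<sigma>: "\<sigma> \<in> saturation A M" and \<tau>: "\<tau> \<in> orbit A \<sigma>"
  then have top: "\<sigma> \<in> topspace (space_of A)" "\<tau> \<in> topspace (space_of A)"
    using orbit_subset_topspace[OF A] by (auto simp: saturation_def)
  obtain \<upsilon> where "\<upsilon> \<in> M" "\<upsilon> \<in> orbit A \<sigma>"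
    using \<sigma> by (auto simp: saturation_def)
  then have "\<upsilon> \<in> orbit A \<tau>"
    using mem_orbit_trans[OF A top(2) mem_orbit_sym[OF A top(1) \<tau>]] by blast
  then show "\<tau> \<in> saturation A M"
    using \<open>\<upsilon> \<in> M\<close> top by (auto simp: saturation_def)
qed (auto simp: saturation_def)

lemma saturation_subset_invariant:
  assumes A: "continuous_groupoid_action A" and "invariant A M" "U \<subseteq> M"
  shows "saturation A U \<subseteq> M"
  using assms(2,3) mem_orbit_sym[OF A]
  unfolding saturation_def invariant_iff_orbits by blast

text \<open>
  Suppose that \<open>\<xi> \<bullet> \<sigma> \<in> U\<close>. By continuity \<open>\<eta> \<bullet> \<tau> \<in> U\<close> for all composable \<open>\<eta>\<close> near \<open>\<xi>\<close> and \<open>\<tau>\<close>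
  near \<open>\<sigma>\<close>. As the source map is open, the sources of the arrows near \<open>\<xi>\<close> fill a neighbourhood of the
  anchor of \<open>\<sigma>\<close>, so every \<open>\<tau>\<close> close enough to \<open>\<sigma>\<close> is moved into \<open>U\<close> by some such \<open>\<eta>\<close>.
\<close>

lemma openin_saturation:
  assumes A: "continuous_groupoid_action A" and G: "open_groupoid (groupoid A)"
    and U: "openin (space_of A) U"
  shows "openin (space_of A) (saturation A U)"
proof (subst openin_subopen, intro ballI)
  fix \<sigma> assume "\<sigma> \<in> saturation A U"
  then have \<sigma>: "\<sigma> \<in> topspace (space_of A)" and "orbit A \<sigma> \<inter> U \<noteq> {}"
    by (auto simp: saturation_def)
  then obtain \<xi> where \<xi>: "(\<xi>, \<sigma>) \<in> actable A" "act A \<xi> \<sigma> \<in> U"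
    by (auto simp: mem_orbit_iff[OF \<sigma>])
  let ?Y = "prod_topology (arrows (groupoid A)) (space_of A)"
  let ?P = "{p \<in> topspace (subtopology ?Y (actable A)). (\<lambda>(\<xi>, \<sigma>). act A \<xi> \<sigma>) p \<in> U}"
  have "continuous_map (subtopology ?Y (actable A)) (space_of A) (\<lambda>(\<xi>, \<sigma>). act A \<xi> \<sigma>)"
    using A by (simp add: continuous_groupoid_action_def)
  then have "openin (subtopology ?Y (actable A)) ?P"
    using U by (rule openin_continuous_map_preimage)
  then obtain Q where Q: "openin ?Y Q" and PQ: "?P = Q \<inter> actable A"
    by (auto simp: openin_subtopology)
  have "(\<xi>, \<sigma>) \<in> ?P"
    using \<xi> by (auto simp: actable_def)
  then have "(\<xi>, \<sigma>) \<in> Q"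
    using PQ by blast
  then obtain W V where W: "openin (arrows (groupoid A)) W" "\<xi> \<in> W"
    and V: "openin (space_of A) V" "\<sigma> \<in> V" and "W \<times> V \<subseteq> Q"
    using Q unfolding openin_prod_topology_alt by metis
  let ?N = "{\<tau> \<in> topspace (space_of A). anchor A \<tau> \<in> src (groupoid A) ` W}"
  have "openin (unit_space (groupoid A)) (src (groupoid A) ` W)"
    using G W unfolding open_groupoid_def open_map_def by blast
  moreover have "continuous_map (space_of A) (unit_space (groupoid A)) (anchor A)"
    using A by (simp add: continuous_groupoid_action_def)
  ultimately have "openin (space_of A) ?N"
    using openin_continuous_map_preimage by blast
  then have "openin (space_of A) (V \<inter> ?N)"
    using V by blast
  moreover have "\<sigma> \<in> V \<inter> ?N"
    using V W \<xi> \<sigma> by (auto simp: actable_def intro!: image_eqI[of _ _ \<xi>])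
  moreover have "V \<inter> ?N \<subseteq> saturation A U"
  proof
    fix \<tau> assume \<tau>: "\<tau> \<in> V \<inter> ?N"
    then obtain \<eta> where \<eta>: "\<eta> \<in> W" "anchor A \<tau> = src (groupoid A) \<eta>"
      by blast
    then have act: "(\<eta>, \<tau>) \<in> actable A"
      using \<tau> openin_subset[OF W(1)] by (auto simp: actable_def)
    then have "(\<eta>, \<tau>) \<in> ?P"
      using PQ \<open>W \<times> V \<subseteq> Q\<close> \<eta> \<tau> by blast
    then have "act A \<eta> \<tau> \<in> U"
      by simp
    moreover have "act A \<eta> \<tau> \<in> orbit A \<tau>"
      using act \<tau> mem_orbit_iff[of \<tau> A] by blast
    ultimately show "\<tau> \<in> saturation A U"
      using \<tau> unfolding saturation_def by blast
  qed
  ultimately show "\<exists>T. openin (space_of A) T \<and> \<sigma> \<in> T \<and> T \<subseteq> saturation A U"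
    by blast
qed

text \<open>
  The saturation of the interior of an invariant set is an open subset of it, hence no larger than the
  interior.
\<close>

lemma invariant_interior:
  assumes A: "continuous_groupoid_action A" and G: "open_groupoid (groupoid A)"
    and M: "invariant A M"
  shows "invariant A (space_of A interior_of M)"
proof -
  let ?I = "space_of A interior_of M"
  have "saturation A ?I \<subseteq> ?I"
    using saturation_subset_invariant[OF A M interior_of_subset]
    by (intro interior_of_maximal openin_saturation[OF A G]) auto
  then have "saturation A ?I = ?I"
    using subset_saturation[OF A interior_of_subset_topspace] by (rule equalityI)
  then show ?thesis
    using invariant_saturation[OF A] by metis
qed

lemma invariant_closure:
  assumes A: "continuous_groupoid_action A" and G: "open_groupoid (groupoid A)"
    and M: "invariant A M"
  shows "invariant A (space_of A closure_of M)"
  unfolding closure_of_interior_of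
  by (intro invariant_complement[OF A] invariant_interior[OF A G] M)

section \<open>Comparison with the density of open invariant sets\<close>

definition open_invariant_sets_dense :: "('g, 's) groupoid_action \<Rightarrow> bool" where
  "open_invariant_sets_dense A \<longleftrightarrow>
     (\<forall>U. openin (space_of A) U \<and> U \<noteq> {} \<and> invariant A U \<longrightarrow> dense_in (space_of A) U)"

lemma recurrently_transitive_iff:
  assumes A: "continuous_groupoid_action A" and G: "open_groupoid (groupoid A)"
  shows "recurrently_transitive A \<longleftrightarrow> open_invariant_sets_dense A"
proof
  assume rec: "recurrently_transitive A"
  show "open_invariant_sets_dense A"
    unfolding open_invariant_sets_dense_def
  proof (intro allI impI)
    fix U assume U: "openin (space_of A) U \<and> U \<noteq> {} \<and> invariant A U"
    have "U \<inter> V \<noteq> {}" if "openin (space_of A) V" "V \<noteq> {}" for V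
    proof -
      have "recurrence_set A U V \<noteq> {}"
        using rec U that by (simp add: recurrently_transitive_def)
      then obtain \<sigma> where "\<sigma> \<in> U" "orbit A \<sigma> \<inter> V \<noteq> {}"
        unfolding recurrence_set_nonempty_iff_orbits by blast
      moreover have "orbit A \<sigma> \<subseteq> U"
        using U \<open>\<sigma> \<in> U\<close> by (simp add: invariant_iff_orbits)
      ultimately show ?thesis
        by blast
    qed
    then show "dense_in (space_of A) U"
      using U by (simp add: dense_inI openin_subset)
  qed
next
  assume dense: "open_invariant_sets_dense A"
  show "recurrently_transitive A"
    unfolding recurrently_transitive_def recurrence_set_nonempty_iff_orbits
  proof (intro allI impI)
    fix U V
    assume UV: "openin (space_of A) U \<and> U \<noteq> {} \<and> openin (space_of A) V \<and> V \<noteq> {}"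
    let ?S = "saturation A V"
    have "openin (space_of A) ?S"
      using openin_saturation[OF A G] UV by blast
    moreover have "?S \<noteq> {}"
      using subset_saturation[OF A openin_subset] UV by blast
    ultimately have "dense_in (space_of A) ?S"
      using dense invariant_saturation[OF A] unfolding open_invariant_sets_dense_def by blast
    then have "?S \<inter> U \<noteq> {}"
      using dense_inD UV by blast
    then show "\<exists>\<sigma>\<in>U. orbit A \<sigma> \<inter> V \<noteq> {}"
      by (auto simp: saturation_def)
  qed
qed

lemma topologically_transitive_iff:
  assumes A: "continuous_groupoid_action A" and G: "open_groupoid (groupoid A)"
  shows "topologically_transitive A \<longleftrightarrow> open_invariant_sets_dense A"
proof
  assume trans: "topologically_transitive A"
  have "dense_in (space_of A) U"
    if "openin (space_of A) U" "U \<noteq> {}" "invariant A U" for U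
  proof -
    have "U \<subseteq> space_of A interior_of (space_of A closure_of U)"
      by (intro interior_of_maximal closure_of_subset openin_subset that)
    then have "\<not> nowhere_dense_in (space_of A) U"
      using that(2) unfolding nowhere_dense_in_def by blast
    then show ?thesis
      using trans that(3) unfolding topologically_transitive_def by blast
  qed
  then show "open_invariant_sets_dense A"
    unfolding open_invariant_sets_dense_def by blast
next
  assume dense: "open_invariant_sets_dense A"
  show "topologically_transitive A"
    unfolding topologically_transitive_def
  proof (intro allI impI disjCI)
    fix M assume M: "invariant A M" and "\<not> nowhere_dense_in (space_of A) M"
    let ?C = "space_of A closure_of M"
    have sub: "M \<subseteq> topspace (space_of A)"
      using M by (simp add: invariant_iff_orbits)
    then have "space_of A interior_of ?C \<noteq> {}"
      using \<open>\<not> nowhere_dense_in _ _\<close> by (simp add: nowhere_dense_in_def)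
    then have "dense_in (space_of A) (space_of A interior_of ?C)"
      using dense invariant_interior[OF A G invariant_closure[OF A G M]]
      unfolding open_invariant_sets_dense_def by simp
    moreover have "space_of A closure_of (space_of A interior_of ?C) \<subseteq> ?C"
      by (simp add: closure_of_minimal interior_of_subset)
    ultimately have "topspace (space_of A) \<subseteq> ?C"
      by (simp add: dense_in_def)
    then show "dense_in (space_of A) M"
      using sub closure_of_subset_topspace[of "space_of A" M] by (auto simp: dense_in_def)
  qed
qed

text \<open>
  If \<open>U\<close> is open, invariant, non-void and not dense, then its complement and its closure are two proper
  closed invariant sets that cover \<open>\<Sigma>\<close>. Conversely, given such a cover \<open>C \<union> D\<close>, the complement of \<open>C\<close>
  is open and invariant, and it is not dense, being contained in \<open>D\<close>.
\<close>

lemma not_union_of_proper_closed_invariant_iff: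
  assumes A: "continuous_groupoid_action A" and G: "open_groupoid (groupoid A)"
  shows "\<not> (\<exists>C D. closedin (space_of A) C \<and> invariant A C \<and> C \<noteq> topspace (space_of A) \<and>
                closedin (space_of A) D \<and> invariant A D \<and> D \<noteq> topspace (space_of A) \<and>
                topspace (space_of A) = C \<union> D)
    \<longleftrightarrow> open_invariant_sets_dense A"
    (is "\<not> ?cover \<longleftrightarrow> _")
proof -
  let ?T = "space_of A"
  have "\<not> open_invariant_sets_dense A" if ?cover
  proof -
    from that obtain C D where C: "closedin ?T C" "invariant A C" "C \<noteq> topspace ?T"
      and D: "closedin ?T D" "D \<noteq> topspace ?T" and cover: "topspace ?T = C \<union> D"
      by blast
    let ?U = "topspace ?T - C"
    have "?T closure_of ?U \<subseteq> D"
      using D cover by (intro closure_of_minimal) auto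
    then have "\<not> dense_in ?T ?U"
      using D closedin_subset unfolding dense_in_def by blast
    moreover have "openin ?T ?U" "invariant A ?U" "?U \<noteq> {}"
      using C invariant_complement[OF A] closedin_subset by blast+
    ultimately show ?thesis
      unfolding open_invariant_sets_dense_def by blast
  qed
  moreover have ?cover if "\<not> open_invariant_sets_dense A"
  proof -
    from that obtain U where U: "openin ?T U" "U \<noteq> {}" "invariant A U" "\<not> dense_in ?T U"
      unfolding open_invariant_sets_dense_def by blast
    have sub: "U \<subseteq> topspace ?T"
      using U openin_subset by blast
    have "?T closure_of U \<noteq> topspace ?T"
      using U sub by (simp add: dense_in_def)
    moreover have "topspace ?T = (topspace ?T - U) \<union> ?T closure_of U"
      using sub closure_of_subset[OF sub] closure_of_subset_topspace[of ?T U] by blast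
    moreover have "closedin ?T (topspace ?T - U)" "topspace ?T - U \<noteq> topspace ?T"
      using U sub by auto
    ultimately show ?thesis
      using invariant_complement[OF A U(3)] invariant_closure[OF A G U(3)] closedin_closure_of
      by blast
  qed
  ultimately show ?thesis by blast
qed

section \<open>Dense orbits\<close>

lemma pointwise_transitive_imp_recurrently_transitive:
  assumes A: "continuous_groupoid_action A" and "pointwise_transitive A"
  shows "recurrently_transitive A"
  unfolding recurrently_transitive_def recurrence_set_nonempty_iff_orbits
proof (intro allI impI)
  fix U V
  assume UV: "openin (space_of A) U \<and> U \<noteq> {} \<and> openin (space_of A) V \<and> V \<noteq> {}"
  obtain \<sigma> where \<sigma>: "\<sigma> \<in> topspace (space_of A)" and "dense_in (space_of A) (orbit A \<sigma>)"
    using assms(2) by (auto simp: pointwise_transitive_def)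
  then have meet: "orbit A \<sigma> \<inter> W \<noteq> {}" if "openin (space_of A) W" "W \<noteq> {}" for W
    using that by (simp add: dense_inD)
  obtain \<tau> where \<tau>: "\<tau> \<in> orbit A \<sigma>" "\<tau> \<in> U"
    using meet UV by blast
  obtain \<upsilon> where \<upsilon>: "\<upsilon> \<in> orbit A \<sigma>" "\<upsilon> \<in> V"
    using meet UV by blast
  have "\<tau> \<in> topspace (space_of A)"
    using \<tau>(1) orbit_subset_topspace[OF A \<sigma>] by blast
  from mem_orbit_trans[OF A this mem_orbit_sym[OF A \<sigma> \<tau>(1)] \<upsilon>(1)]
  show "\<exists>\<sigma>\<in>U. orbit A \<sigma> \<inter> V \<noteq> {}"
    using \<tau> \<upsilon> by blast
qed

text \<open>
  The orbit of \<open>\<sigma>\<close> is dense as soon as it meets each non-void member of a countable base, that is,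
  as soon as \<open>\<sigma>\<close> lies in countably many saturations. These are open and dense, so the Baire
  property provides such a point.
\<close>

lemma open_invariant_sets_dense_imp_pointwise_transitive:
  assumes A: "continuous_groupoid_action A" and G: "open_groupoid (groupoid A)"
    and baire: "Baire_space (space_of A)" and sc: "second_countable (space_of A)"
    and nonempty: "topspace (space_of A) \<noteq> {}"
    and dense: "open_invariant_sets_dense A"
  shows "pointwise_transitive A"
proof -
  let ?T = "space_of A"
  obtain \<B> where "countable \<B>" and open_base: "\<And>B. B \<in> \<B> \<Longrightarrow> openin ?T B"
    and base: "\<And>U \<sigma>. openin ?T U \<Longrightarrow> \<sigma> \<in> U \<Longrightarrow> \<exists>B\<in>\<B>. \<sigma> \<in> B \<and> B \<subseteq> U"
    using sc unfolding second_countable_def by metis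
  define \<D> where "\<D> = saturation A ` (\<B> - {{}})"
  have "openin ?T (saturation A B) \<and> dense_in ?T (saturation A B)" if "B \<in> \<B> - {{}}" for B
  proof -
    have B: "openin ?T B" "B \<noteq> {}"
      using that open_base by auto
    then have "saturation A B \<noteq> {}"
      using subset_saturation[OF A openin_subset] by blast
    then show ?thesis
      using dense openin_saturation[OF A G B(1)] invariant_saturation[OF A]
      unfolding open_invariant_sets_dense_def by blast
  qed
  then have "\<forall>D\<in>\<D>. openin ?T D \<and> dense_in ?T D"
    by (simp add: \<D>_def)
  moreover have "countable \<D>"
    using \<open>countable \<B>\<close> by (simp add: \<D>_def)
  ultimately have "dense_in ?T (topspace ?T \<inter> \<Inter>\<D>)"
    using baire by (simp add: Baire_space_def)
  then have "topspace ?T \<inter> \<Inter>\<D> \<noteq> {}"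
    using nonempty unfolding dense_in_def by (metis closure_of_empty)
  then obtain \<sigma> where \<sigma>: "\<sigma> \<in> topspace ?T" "\<sigma> \<in> \<Inter>\<D>"
    by blast
  have "orbit A \<sigma> \<inter> V \<noteq> {}" if V: "openin ?T V" "V \<noteq> {}" for V
  proof -
    obtain B where "B \<in> \<B> - {{}}" "B \<subseteq> V"
      using base V by blast
    then have "\<sigma> \<in> saturation A B"
      using \<sigma>(2) unfolding \<D>_def by blast
    then show ?thesis
      using \<open>B \<subseteq> V\<close> unfolding saturation_def by blast
  qed
  then have "dense_in ?T (orbit A \<sigma>)"
    by (intro dense_inI orbit_subset_topspace[OF A \<sigma>(1)])
  then show ?thesis
    using \<sigma>(1) unfolding pointwise_transitive_def by blast
qed

section \<open>The equivalence\<close>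

theorem proposition4p5:
  fixes A :: "('g, 's) groupoid_action"
  assumes "continuous_groupoid_action A"
    and "open_groupoid (groupoid A)"
    and "Baire_space (space_of A)"
    and "second_countable (space_of A)"
    and nonempty: "topspace (space_of A) \<noteq> {}"
  shows "(topologically_transitive A \<longleftrightarrow> recurrently_transitive A) \<and>
    (recurrently_transitive A \<longleftrightarrow> pointwise_transitive A) \<and>
    (pointwise_transitive A \<longleftrightarrow>
       \<not> (\<exists>C D. closedin (space_of A) C \<and> invariant A C \<and> C \<noteq> topspace (space_of A) \<and>
                closedin (space_of A) D \<and> invariant A D \<and> D \<noteq> topspace (space_of A) \<and>
                topspace (space_of A) = C \<union> D)) \<and>
    (pointwise_transitive A \<longleftrightarrow>
       (\<forall>U. openin (space_of A) U \<and> U \<noteq> {} \<and> invariant A U \<longrightarrow> dense_in (space_of A) U))"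
proof -
  note A = assms(1) and G = assms(2)
  have "pointwise_transitive A \<longleftrightarrow> open_invariant_sets_dense A"
    using pointwise_transitive_imp_recurrently_transitive[OF A] recurrently_transitive_iff[OF A G]
      open_invariant_sets_dense_imp_pointwise_transitive[OF A G assms(3,4) nonempty]
    by blast
  then show ?thesis
    unfolding topologically_transitive_iff[OF A G] recurrently_transitive_iff[OF A G]
      not_union_of_proper_closed_invariant_iff[OF A G]
    by (simp add: open_invariant_sets_dense_def)
qed

end
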